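(* Let $\Gamma(V,E)$ be a finite graph with vertex set $V$, edge set $E$, and $c$ connected components. For $k=0,1,2,3$, let $\mathcal{L}(k)$ be the set of ordered pairs $(A,B)$ of subsets of $E$ such that the symmetric difference $A\,\Delta\, B$ is a disjoint union of minimal cutsets of $\Gamma$ and $|A|+|B|\equiv |E|+k \pmod 4$; and let $\bar{\mathcal{L}}(k)$ be the set of ordered pairs $(A,B)$ of subsets of $E$ such that $A\,\Delta\,B$ is a disjoint union of cycles of $\Gamma$ and $|A|+|B|\equiv |E|+k \pmod 4$. Then $$|\mathcal{L}(1)|=|\mathcal{L}(3)| \quad\text{and}\quad |\mathcal{L}(0)|-|\mathcal{L}(2)| = 2^{|E|-c}P(\Gamma;2),$$ $$|\bar{\mathcal{L}}(1)|=|\bar{\mathcal{L}}(3)| \quad\text{and}\quad |\bar{\mathcal{L}}(0)|-|\bar{\mathcal{L}}(2)| = 2^{|E|}F(\Gamma;2),$$ where $P(\Gamma;\lambda)$ is the chromatic polynomial and $F(\Gamma;\lambda)$ is the flow polynomial of $\Gamma$.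
   Context: A minimal cutset of a graph is a minimal nonempty set of edges whose removal increases the number of connected components; the empty set counts as a (trivial) disjoint union of minimal cutsets, and likewise of cycles. The flow polynomial $F(\Gamma;\lambda)$ evaluated at a positive integer $\lambda$ is the number of nowhere-zero flows on $\Gamma$ (for any fixed orientation) with values in an Abelian group of order $\lambda$. *)

theory Defs
  imports
    "HOL-Algebra.FiniteProduct"
    "HOL-Computational_Algebra.Polynomial"
    "HOL-Library.Disjoint_Sets"
    "HOL-Library.FuncSet"
    "HOL-Number_Theory.Cong"
begin

(* Undirected graphs, with loops (one endpoint) and parallel edges allowed. *)
record ('v, 'e) multigraph =
  verts :: "'v set"
  edges :: "'e set"
  ends :: "'e \<Rightarrow> 'v set"

definition finite_multigraph :: "('v, 'e) multigraph \<Rightarrow> bool" where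
  "finite_multigraph G \<longleftrightarrow> finite (verts G) \<and> finite (edges G) \<and>
     (\<forall>e\<in>edges G. ends G e \<subseteq> verts G \<and> card (ends G e) \<in> {1, 2})"

definition connected_via :: "('v, 'e) multigraph \<Rightarrow> 'e set \<Rightarrow> 'v rel" where
  "connected_via G S =
     {(u, v). u \<in> verts G \<and> v \<in> verts G \<and> (u, v) \<in> {(x, y). \<exists>e\<in>S. ends G e = {x, y}}\<^sup>*}"

(* The number of connected components of the spanning subgraph with edge set S. *)
definition num_components :: "('v, 'e) multigraph \<Rightarrow> 'e set \<Rightarrow> nat" where
  "num_components G S = card (verts G // connected_via G S)"

definition disconnecting :: "('v, 'e) multigraph \<Rightarrow> 'e set \<Rightarrow> bool" where
  "disconnecting G C \<longleftrightarrow> C \<subseteq> edges G \<and> C \<noteq> {} \<and>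
     num_components G (edges G - C) > num_components G (edges G)"

definition minimal_cutset :: "('v, 'e) multigraph \<Rightarrow> 'e set \<Rightarrow> bool" where
  "minimal_cutset G C \<longleftrightarrow> disconnecting G C \<and> (\<forall>D. D \<subset> C \<longrightarrow> \<not> disconnecting G D)"

(* Edge sets of cycles: a loop is a cycle of length 1 and a pair of parallel edges
   a cycle of length 2, whence the condition that the edges be distinct. *)
definition cycle :: "('v, 'e) multigraph \<Rightarrow> 'e set \<Rightarrow> bool" where
  "cycle G C \<longleftrightarrow> C \<subseteq> edges G \<and>
     (\<exists>vs es. es \<noteq> [] \<and> length vs = length es \<and> distinct vs \<and> distinct es \<and> set es = C \<and>
        (\<forall>i<length es. ends G (es ! i) = {vs ! i, vs ! (Suc i mod length es)}))"

(* The empty family is allowed, so the empty set qualifies. *)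
definition disjoint_union_of :: "('e set \<Rightarrow> bool) \<Rightarrow> 'e set \<Rightarrow> bool" where
  "disjoint_union_of Q S \<longleftrightarrow> (\<exists>F. (\<forall>C\<in>F. Q C) \<and> disjoint F \<and> S = \<Union>F)"

definition cutset_pairs :: "('v, 'e) multigraph \<Rightarrow> nat \<Rightarrow> ('e set \<times> 'e set) set" where
  "cutset_pairs G k = {(A, B). A \<subseteq> edges G \<and> B \<subseteq> edges G \<and>
     disjoint_union_of (minimal_cutset G) (sym_diff A B) \<and>
     [card A + card B = card (edges G) + k] (mod 4)}"

definition cycle_pairs :: "('v, 'e) multigraph \<Rightarrow> nat \<Rightarrow> ('e set \<times> 'e set) set" where
  "cycle_pairs G k = {(A, B). A \<subseteq> edges G \<and> B \<subseteq> edges G \<and>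
     disjoint_union_of (cycle G) (sym_diff A B) \<and>
     [card A + card B = card (edges G) + k] (mod 4)}"

(* The two endpoints of an edge get different colours; a loop admits no proper colouring. *)
definition proper_colourings :: "('v, 'e) multigraph \<Rightarrow> nat \<Rightarrow> ('v \<Rightarrow> nat) set" where
  "proper_colourings G n = {f \<in> verts G \<rightarrow>\<^sub>E {..<n}.
     \<forall>e\<in>edges G. \<forall>u v. ends G e = {u, v} \<longrightarrow> f u \<noteq> f v}"

definition chromatic_poly :: "('v, 'e) multigraph \<Rightarrow> int poly" where
  "chromatic_poly G = (THE p. \<forall>n. poly p (int n) = int (card (proper_colourings G n)))"

definition orientation :: "('v, 'e) multigraph \<Rightarrow> ('e \<Rightarrow> 'v) \<Rightarrow> ('e \<Rightarrow> 'v) \<Rightarrow> bool" where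
  "orientation G t h \<longleftrightarrow> (\<forall>e\<in>edges G. ends G e = {t e, h e})"

(* t and h give the tail and head of each edge; the Abelian group H is written multiplicatively. *)
definition nowhere_zero_flows ::
    "('v, 'e) multigraph \<Rightarrow> ('e \<Rightarrow> 'v) \<Rightarrow> ('e \<Rightarrow> 'v) \<Rightarrow> ('h, 'b) monoid_scheme \<Rightarrow> ('e \<Rightarrow> 'h) set" where
  "nowhere_zero_flows G t h H = {f \<in> edges G \<rightarrow>\<^sub>E (carrier H - {\<one>\<^bsub>H\<^esub>}).
     \<forall>v\<in>verts G. finprod H f {e \<in> edges G. t e = v} = finprod H f {e \<in> edges G. h e = v}}"

(* The defining property is required for every orientation and every finite Abelian group;
   groups carried by sets of integers represent all finite groups up to isomorphism. *)
definition flow_poly :: "('v, 'e) multigraph \<Rightarrow> int poly" where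
  "flow_poly G = (THE p. \<forall>t h (H :: int monoid).
     orientation G t h \<longrightarrow> comm_group H \<longrightarrow> finite (carrier H) \<longrightarrow>
     poly p (int (card (carrier H))) = int (card (nowhere_zero_flows G t h H)))"

end

theory Submission
  imports Defs "HOL-Algebra.Elementary_Groups"
begin

text \<open>If \<open>A \<triangle> B\<close> misses an edge, toggling that edge in both \<open>A\<close> and \<open>B\<close> keeps the symmetric
  difference and shifts \<open>|A| + |B|\<close> by 2 modulo 4, so such pairs cancel in each difference. The
  remaining pairs are \<open>(A, E - A)\<close>, which have \<open>|A| + |B| = |E|\<close> and occur only if \<open>E\<close> itself is a
  disjoint union of minimal cutsets (respectively cycles). The former means that \<open>E\<close> is a
  coboundary, i.e. that the graph is bipartite, in which case there are \<open>2^c\<close> proper 2-colourings;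
  the latter means that all degrees are even, i.e. that the constant 1 is a flow modulo 2. The
  chromatic polynomial exists by inclusion-exclusion over sets of monochromatic edges, the flow
  polynomial by deletion and contraction.\<close>

subsection \<open>Pairs with prescribed symmetric difference\<close>

text \<open>The counting works for an arbitrary predicate on edge sets, so all graph theory is
  confined to one question: when does the full edge set satisfy it? Modulo 2, coboundaries form the
  cut space and even edge sets the cycle space. Removing from a member of either space a contained
  member leaves a smaller member of the same space; so once every nonempty member is known to
  contain a minimal cutset or a cycle, peeling these off decomposes it. Minimal cutsets are defined
  by component counts, and the bridge to coboundaries is that a count grows exactly if some deleted
  edge loses the connection between its ends.

  Both polynomials are definite descriptions, hence unusable before existence and uniqueness are
  shown. For flows a single polynomial must serve all orientations and all finite Abelian groups at
  once, so it has to be built from the end sets of the edges alone; uniqueness holds because the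
  integers modulo \<open>n\<close> realise every positive order.\<close>

lemma card_toggle_pair:
  assumes "finite A" "finite B" "e \<notin> sym_diff A B"
  shows "[card (sym_diff A {e}) + card (sym_diff B {e}) = card A + card B + 2] (mod 4)"
proof (cases "e \<in> A")
  case True
  then have "e \<in> B" using assms by auto
  have "sym_diff A {e} = A - {e}" "sym_diff B {e} = B - {e}"
    using True \<open>e \<in> B\<close> by auto
  moreover have "card A = Suc (card (A - {e}))" "card B = Suc (card (B - {e}))"
    using card.remove assms True \<open>e \<in> B\<close> by metis+
  \<comment> \<open>Here the sum drops by 2 instead of growing; since -2 and 2 agree modulo 4, the
    two cases give the same residue.\<close>
  ultimately have "card A + card B + 2 = card (sym_diff A {e}) + card (sym_diff B {e}) + 4"
    by simp
  then show ?thesis by (simp add: cong_def)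
next
  case False
  then have "e \<notin> B" using assms by auto
  have "sym_diff A {e} = insert e A" "sym_diff B {e} = insert e B"
    using False \<open>e \<notin> B\<close> by auto
  then show ?thesis using assms False \<open>e \<notin> B\<close> by (simp add: cong_def)
qed

text \<open>Common form of \<open>cutset_pairs\<close> and \<open>cycle_pairs\<close>, so that both
  halves of the theorem become instances of one count.\<close>

definition sym_diff_pairs :: "'e set \<Rightarrow> ('e set \<Rightarrow> bool) \<Rightarrow> nat \<Rightarrow> ('e set \<times> 'e set) set" where
  "sym_diff_pairs E Q k = {(A, B). A \<subseteq> E \<and> B \<subseteq> E \<and> Q (sym_diff A B) \<and>
     [card A + card B = card E + k] (mod 4)}"

text \<open>Toggling one edge outside the symmetric difference in both sets shifts the residue by 2.\<close>
lemma card_sym_diff_pairs_shift: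
  assumes "finite E" "\<not> Q E" and k: "[k + 2 = k'] (mod 4)"
  shows "card (sym_diff_pairs E Q k) = card (sym_diff_pairs E Q k')"
proof -
  \<comment> \<open>The edge to toggle depends on the symmetric difference alone. Toggling preserves
    that difference, so a second application picks the same edge and \<open>\<phi>\<close> is an
    involution.\<close>
  define ch where "ch D = (SOME e. e \<in> E - D)" for D
  have ch: "ch D \<in> E" "ch D \<notin> D" if "D \<subseteq> E" "Q D" for D
  proof -
    have "D \<noteq> E" using that assms by auto
    then have "\<exists>e. e \<in> E - D" using that by auto
    then have "ch D \<in> E - D" unfolding ch_def by (rule someI_ex)
    then show "ch D \<in> E" "ch D \<notin> D" by auto
  qed
  define \<phi> where "\<phi> = (\<lambda>(A, B). (sym_diff A {ch (sym_diff A B)}, sym_diff B {ch (sym_diff A B)}))"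
  have sd: "sym_diff (sym_diff A {e}) (sym_diff B {e}) = sym_diff A B" for A B and e :: 'a
    by auto
  have inv: "\<phi> (\<phi> p) = p" for p
    unfolding \<phi>_def by (cases p) (simp only: prod.case sd, auto)
  have maps: "\<phi> p \<in> sym_diff_pairs E Q k'" if p: "p \<in> sym_diff_pairs E Q k" and k: "[k + 2 = k'] (mod 4)" for p k k'
  proof -
    obtain A B where [simp]: "p = (A, B)" by (cases p)
    let ?e = "ch (sym_diff A B)"
    have AB: "A \<subseteq> E" "B \<subseteq> E" "Q (sym_diff A B)" "[card A + card B = card E + k] (mod 4)"
      using p by (auto simp: sym_diff_pairs_def)
    have "sym_diff A B \<subseteq> E" using AB by auto
    note e = ch[OF this AB(3)]
    have "[card (sym_diff A {?e}) + card (sym_diff B {?e}) = card A + card B + 2] (mod 4)"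
      using AB assms e by (intro card_toggle_pair) (auto intro: finite_subset)
    also have "[card A + card B + 2 = card E + k + 2] (mod 4)"
      using cong_add[OF AB(4) cong_refl] .
    also have "[card E + k + 2 = card E + k'] (mod 4)"
      using k by (simp only: add.assoc cong_add_lcancel_nat)
    finally show ?thesis
      using AB e unfolding sym_diff_pairs_def \<phi>_def by (simp add: sd) auto
  qed
  \<comment> \<open>Adding 2 twice is the identity modulo 4, so the roles of \<open>k\<close> and
    \<open>k'\<close> are symmetric and \<open>maps\<close> applies in both directions.\<close>
  have "[k' + 2 = k + 2 + 2] (mod 4)" by (rule cong_add[OF cong_sym[OF k] cong_refl])
  also have "[k + 2 + 2 = k] (mod 4)" by (simp only: cong_def add.assoc) simp
  finally have k': "[k' + 2 = k] (mod 4)" .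
  have "bij_betw \<phi> (sym_diff_pairs E Q k) (sym_diff_pairs E Q k')"
    by (rule bij_betw_byWitness[where f' = \<phi>]) (use inv maps k k' in auto)
  then show ?thesis by (rule bij_betw_same_card)
qed

text \<open>Pairs with symmetric difference \<open>E\<close> are split off as \<open>?full\<close>.
  The rest is governed by \<open>?R\<close>, which fails at \<open>E\<close> whatever
  \<open>Q\<close> is, so the shift lemma applies to it.\<close>

lemma card_sym_diff_pairs:
  assumes fin: "finite E"
  shows "card (sym_diff_pairs E Q 1) = card (sym_diff_pairs E Q 3)"
    and "int (card (sym_diff_pairs E Q 0)) =
      int (card (sym_diff_pairs E Q 2)) + (if Q E then 2 ^ card E else 0)"
proof -
  let ?R = "\<lambda>D. Q D \<and> D \<noteq> E"
  let ?full = "\<lambda>k. {(A, B). A \<subseteq> E \<and> B = E - A \<and> Q E \<and> [card E = card E + k] (mod 4)}"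
  have full: "A \<subseteq> E \<and> B \<subseteq> E \<and> sym_diff A B = E \<longleftrightarrow> A \<subseteq> E \<and> B = E - A" for A B
    by blast
  have cardE: "card A + card (E - A) = card E" if "A \<subseteq> E" for A
    using that fin by (simp add: card_Diff_subset card_mono finite_subset)
  have "sym_diff_pairs E Q k = sym_diff_pairs E ?R k \<union> ?full k" (is "_ = ?U") for k
  proof -
    have "(A, B) \<in> sym_diff_pairs E Q k \<longleftrightarrow> (A, B) \<in> ?U" for A B
      using full[of A B] cardE[of A] unfolding sym_diff_pairs_def by (cases "sym_diff A B = E") auto
    then show ?thesis by auto
  qed
  moreover have "sym_diff_pairs E ?R k \<inter> ?full k = {}" for k
    unfolding sym_diff_pairs_def by auto
  moreover have "finite (sym_diff_pairs E P k)" for P k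
    by (rule finite_subset[of _ "Pow E \<times> Pow E"]) (auto simp: sym_diff_pairs_def fin)
  ultimately have split: "card (sym_diff_pairs E Q k) = card (sym_diff_pairs E ?R k) + card (?full k)" for k
    by (metis (no_types, lifting) card_Un_disjoint finite_Un)
  have empty: "?full 1 = {}" "?full 3 = {}" "?full 2 = {}"
  proof -
    have "[m = m + r] (mod 4) \<longleftrightarrow> [r = 0] (mod 4)" for m r :: nat
      by (metis cong_add_lcancel_0_nat cong_sym_eq)
    moreover have "\<not> [1 = 0 :: nat] (mod 4)" "\<not> [3 = 0 :: nat] (mod 4)" "\<not> [2 = 0 :: nat] (mod 4)"
      by (simp_all add: cong_def)
    ultimately have "\<not> [m = m + 1] (mod 4)" "\<not> [m = m + 3] (mod 4)" "\<not> [m = m + 2] (mod 4)" for m :: nat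
      by blast+
    then show "?full 1 = {}" "?full 3 = {}" "?full 2 = {}" by simp_all
  qed
  have "card (?full 0) = (if Q E then 2 ^ card E else 0)"
  proof (cases "Q E")
    case True
    then have "?full 0 = (\<lambda>A. (A, E - A)) ` Pow E" by auto
    also have "card \<dots> = card (Pow E)" by (rule card_image) (auto intro: inj_onI)
    finally show ?thesis using True fin by (simp add: card_Pow)
  qed auto
  moreover have "card (?full 2) = 0" by (simp only: empty card.empty)
  ultimately show "int (card (sym_diff_pairs E Q 0)) =
      int (card (sym_diff_pairs E Q 2)) + (if Q E then 2 ^ card E else 0)"
    using split[of 0] split[of 2] card_sym_diff_pairs_shift[of E ?R 0 2] fin
    by (simp add: cong_def)
  have "card (?full 1) = 0" "card (?full 3) = 0" by (simp_all only: empty card.empty)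
  then show "card (sym_diff_pairs E Q 1) = card (sym_diff_pairs E Q 3)"
    using split[of 1] split[of 3] card_sym_diff_pairs_shift[of E ?R 1 3] fin
    by (simp add: cong_def)
qed

subsection \<open>Components, cutsets and coboundaries\<close>

text \<open>Sending an \<open>r\<close>-class to the \<open>s\<close>-class around it is onto, and a
  pair in \<open>s\<close> outside \<open>r\<close> makes two classes collide.\<close>

lemma card_quotient_less:
  assumes fin: "finite A" and r: "equiv A r" and s: "equiv A s" and sub: "r \<subset> s"
  shows "card (A // s) < card (A // r)"
proof -
  have img: "s `` (r `` {x}) = s `` {x}" if "x \<in> A" for x
  proof -
    have "x \<in> r `` {x}" using r that by (rule equiv_class_self)
    moreover have "s `` {y} = s `` {x}" if "y \<in> r `` {x}" for y
    proof -
      have "(x, y) \<in> s" using that sub by blast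
      then show ?thesis using equiv_class_eq[OF s] by blast
    qed
    ultimately show ?thesis by blast
  qed
  have fq: "finite (A // r)" using fin r by (simp add: finite_quotient equiv_def)
  have classes: "A // q = (\<lambda>x. q `` {x}) ` A" for q :: "'a rel" by (auto simp: quotient_def)
  have surj: "A // s = (\<lambda>X. s `` X) ` (A // r)"
    unfolding classes image_image using img by (intro image_cong) auto
  obtain x y where xy: "(x, y) \<in> s" "(x, y) \<notin> r" using sub by auto
  then have A: "x \<in> A" "y \<in> A" using s by (auto simp: equiv_def)
  have "r `` {x} \<noteq> r `` {y}" using xy A r eq_equiv_class by fast
  moreover have "s `` (r `` {x}) = s `` (r `` {y})"
    using img A xy s equiv_class_eq by metis
  ultimately have "\<not> inj_on (\<lambda>X. s `` X) (A // r)"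
    using A by (meson inj_onD quotientI)
  then show ?thesis
    using surj fq by (metis card_image_le eq_card_imp_inj_on le_neq_implies_less)
qed

text \<open>Such functions are functions on the quotient: \<open>\<phi>\<close> pulls back along the
  projection, \<open>\<psi>\<close> evaluates at a chosen representative.\<close>

lemma card_respecting_functions:
  assumes fin: "finite A" and r: "equiv A r"
  shows "card {f \<in> A \<rightarrow>\<^sub>E B. \<forall>(x, y)\<in>r. f x = f y} = card B ^ card (A // r)"
proof -
  define \<phi> :: "('a set \<Rightarrow> 'b) \<Rightarrow> 'a \<Rightarrow> 'b" where "\<phi> g = (\<lambda>x\<in>A. g (r `` {x}))" for g
  define \<psi> :: "('a \<Rightarrow> 'b) \<Rightarrow> 'a set \<Rightarrow> 'b" where "\<psi> f = (\<lambda>X\<in>A // r. f (SOME x. x \<in> X))" for f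
  have rA: "r \<subseteq> A \<times> A" using r by (simp add: equiv_def)
  have some: "(x, SOME y. y \<in> r `` {x}) \<in> r" if "x \<in> A" for x
    using someI[of "\<lambda>y. y \<in> r `` {x}" x] equiv_class_self[OF r that] by simp
  have "bij_betw \<phi> ((A // r) \<rightarrow>\<^sub>E B) {f \<in> A \<rightarrow>\<^sub>E B. \<forall>(x, y)\<in>r. f x = f y}"
  proof (rule bij_betw_byWitness[where f' = \<psi>])
    show "\<forall>g\<in>(A // r) \<rightarrow>\<^sub>E B. \<psi> (\<phi> g) = g"
    proof
      fix g assume g: "g \<in> (A // r) \<rightarrow>\<^sub>E B"
      show "\<psi> (\<phi> g) = g"
      proof (rule extensionalityI[of _ "A // r"])
        fix X assume "X \<in> A // r"
        then obtain x where x: "x \<in> A" "X = r `` {x}" by (auto elim: quotientE)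
        then have "(x, SOME y. y \<in> X) \<in> r" using some[of x] by simp
        then have "r `` {SOME y. y \<in> X} = X" "(SOME y. y \<in> X) \<in> A"
          using equiv_class_eq[OF r] rA x by blast+
        with \<open>X \<in> A // r\<close> show "\<psi> (\<phi> g) X = g X" by (simp add: \<psi>_def \<phi>_def)
      qed (use g in \<open>auto simp: \<psi>_def PiE_def\<close>)
    qed
    show "\<forall>f\<in>{f \<in> A \<rightarrow>\<^sub>E B. \<forall>(x, y)\<in>r. f x = f y}. \<phi> (\<psi> f) = f"
    proof
      fix f assume f: "f \<in> {f \<in> A \<rightarrow>\<^sub>E B. \<forall>(x, y)\<in>r. f x = f y}"
      show "\<phi> (\<psi> f) = f"
      proof (rule extensionalityI[of _ A])
        fix x assume x: "x \<in> A"
        then show "\<phi> (\<psi> f) x = f x" using some[OF x] f quotientI[OF x, of r] by (auto simp: \<psi>_def \<phi>_def)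
      qed (use f in \<open>auto simp: \<phi>_def PiE_def\<close>)
    qed
    show "\<phi> ` ((A // r) \<rightarrow>\<^sub>E B) \<subseteq> {f \<in> A \<rightarrow>\<^sub>E B. \<forall>(x, y)\<in>r. f x = f y}"
    proof safe
      fix g x assume g: "g \<in> (A // r) \<rightarrow>\<^sub>E B"
      show "\<phi> g x \<in> B" if "x \<in> A" using g that by (auto simp: \<phi>_def quotientI)
      show "\<phi> g x = undefined" if "x \<notin> A" using that by (auto simp: \<phi>_def)
    next
      fix g x y assume g: "g \<in> (A // r) \<rightarrow>\<^sub>E B" and xy: "(x, y) \<in> r"
      then show "\<phi> g x = \<phi> g y" using equiv_class_eq[OF r xy] rA by (auto simp: \<phi>_def)
    qed
    show "\<psi> ` {f \<in> A \<rightarrow>\<^sub>E B. \<forall>(x, y)\<in>r. f x = f y} \<subseteq> (A // r) \<rightarrow>\<^sub>E B"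
    proof safe
      fix f X assume f: "f \<in> A \<rightarrow>\<^sub>E B"
      show "\<psi> f X \<in> B" if X: "X \<in> A // r"
      proof -
        obtain x where x: "x \<in> A" "X = r `` {x}" using X by (auto elim: quotientE)
        then have "(SOME y. y \<in> X) \<in> A" using some[of x] rA by auto
        then show ?thesis using f X by (auto simp: \<psi>_def)
      qed
      show "\<psi> f X = undefined" if "X \<notin> A // r" using that by (auto simp: \<psi>_def)
    qed
  qed
  moreover have "finite (A // r)" using fin r by (simp add: finite_quotient equiv_def)
  ultimately show ?thesis by (simp add: bij_betw_same_card[symmetric] card_funcsetE)
qed

section \<open>Connectivity in spanning subgraphs\<close>

lemma equiv_connected_via: "equiv (verts G) (connected_via G S)"
proof (rule equivI)
  let ?R = "{(x, y). \<exists>e\<in>S. ends G e = {x, y}}"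
  have "sym ?R" by (auto simp: sym_def insert_commute)
  then have "sym (?R\<^sup>*)" by (rule sym_rtrancl)
  then show "sym (connected_via G S)" by (auto simp: connected_via_def sym_def)
  show "trans (connected_via G S)" by (auto simp: connected_via_def trans_def)
qed (auto simp: connected_via_def refl_on_def)

lemma connected_via_mono: "S \<subseteq> T \<Longrightarrow> connected_via G S \<subseteq> connected_via G T"
  unfolding connected_via_def by (auto elim!: rtrancl_mono[THEN subsetD, rotated])

lemma connected_via_edge:
  assumes "finite_multigraph G" "e \<in> S" "S \<subseteq> edges G" "ends G e = {u, v}"
  shows "(u, v) \<in> connected_via G S"
proof -
  have "ends G e \<subseteq> verts G" using assms unfolding finite_multigraph_def by blast
  moreover have "(u, v) \<in> {(x, y). \<exists>e\<in>S. ends G e = {x, y}}\<^sup>*" using assms by blast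
  ultimately show ?thesis using assms by (simp add: connected_via_def)
qed

text \<open>Used with three invariants: the class map of a finer connectivity relation, membership
  in a vertex set, and a colouring.\<close>

lemma connected_via_invariant:
  assumes "\<And>e x y. e \<in> S \<Longrightarrow> ends G e = {x, y} \<Longrightarrow> f x = f y"
    and "(u, v) \<in> connected_via G S"
  shows "f u = f v"
proof -
  have "(u, v) \<in> {(x, y). \<exists>e\<in>S. ends G e = {x, y}}\<^sup>*"
    using assms(2) by (simp add: connected_via_def)
  then show ?thesis by (induction rule: rtrancl_induct) (auto dest: assms(1))
qed

lemma ends_cases:
  assumes "finite_multigraph G" "e \<in> edges G"
  obtains u v where "ends G e = {u, v}" "u \<in> verts G" "v \<in> verts G"
proof -
  have "ends G e \<subseteq> verts G" "card (ends G e) = 1 \<or> card (ends G e) = 2"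
    using assms by (auto simp: finite_multigraph_def)
  then show thesis
    using that by (auto simp: card_1_singleton_iff card_2_iff)
qed

text \<open>Deleting \<open>D\<close> refines the partition into components, and the count grows
  exactly if the refinement is proper. If all deleted edges still have connected ends, no path is
  lost.\<close>

lemma disconnecting_iff:
  assumes G: "finite_multigraph G" and D: "D \<subseteq> edges G"
  shows "disconnecting G D \<longleftrightarrow>
    (\<exists>e\<in>D. \<exists>u v. ends G e = {u, v} \<and> (u, v) \<notin> connected_via G (edges G - D))"
proof
  have fin: "finite (verts G)" using G by (simp add: finite_multigraph_def)
  let ?r = "connected_via G (edges G - D)" and ?s = "connected_via G (edges G)"
  have sub: "?r \<subseteq> ?s" by (rule connected_via_mono) auto
  show "\<exists>e\<in>D. \<exists>u v. ends G e = {u, v} \<and> (u, v) \<notin> ?r" if "disconnecting G D"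
  proof (rule ccontr)
    assume "\<not> (\<exists>e\<in>D. \<exists>u v. ends G e = {u, v} \<and> (u, v) \<notin> ?r)"
    then have edge: "(x, y) \<in> ?r" if "e \<in> edges G" "ends G e = {x, y}" for e x y
      using that connected_via_edge[OF G, of e "edges G - D"] by blast
    have "?r `` {x} = ?r `` {y}" if "(x, y) \<in> ?s" for x y
      by (rule connected_via_invariant[OF _ that])
        (use edge equiv_class_eq[OF equiv_connected_via] in metis)
    then have "?s \<subseteq> ?r"
      using eq_equiv_class[OF _ equiv_connected_via] by (fastforce simp: connected_via_def[of G "edges G"])
    then show False using that sub by (simp add: disconnecting_def num_components_def)
  qed
  assume "\<exists>e\<in>D. \<exists>u v. ends G e = {u, v} \<and> (u, v) \<notin> ?r"
  then obtain e u v where e: "e \<in> D" "ends G e = {u, v}" "(u, v) \<notin> ?r" by blast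
  then have "(u, v) \<in> ?s" using connected_via_edge[OF G, of e] D by blast
  then have "?r \<subset> ?s" using sub e by blast
  then show "disconnecting G D"
    using card_quotient_less[OF fin equiv_connected_via equiv_connected_via] D e
    by (auto simp: disconnecting_def num_components_def)
qed

text \<open>The cut of \<open>U\<close>, i.e. the coboundary modulo 2 of its indicator function. It
  contains no loops, and it is all of \<open>edges G\<close> exactly if \<open>U\<close> and its
  complement properly 2-colour the graph.\<close>

definition coboundary :: "('v, 'e) multigraph \<Rightarrow> 'v set \<Rightarrow> 'e set" where
  "coboundary G U = {e \<in> edges G. \<exists>u v. ends G e = {u, v} \<and> u \<in> U \<and> v \<notin> U}"

lemma in_coboundary_iff:
  "e \<in> edges G \<Longrightarrow> ends G e = {u, v} \<Longrightarrow> e \<in> coboundary G U \<longleftrightarrow> (u \<in> U) \<noteq> (v \<in> U)"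
  by (fastforce simp: coboundary_def doubleton_eq_iff)

text \<open>Linearity modulo 2: membership of an edge is the exclusive or of the memberships of its
  ends.\<close>

lemma coboundary_sym_diff:
  assumes "finite_multigraph G"
  shows "coboundary G (sym_diff U W) = sym_diff (coboundary G U) (coboundary G W)"
proof -
  have "e \<in> coboundary G (sym_diff U W) \<longleftrightarrow> e \<in> sym_diff (coboundary G U) (coboundary G W)"
    if "e \<in> edges G" for e
    using that assms by (rule_tac ends_cases[of G e]) (auto simp: in_coboundary_iff)
  moreover have "coboundary G X \<subseteq> edges G" for X by (auto simp: coboundary_def)
  ultimately show ?thesis by blast
qed

text \<open>Membership in \<open>U\<close> is constant along paths that avoid the coboundary, so
  deleting it separates the ends of each of its edges.\<close>

lemma disconnecting_coboundary:
  assumes G: "finite_multigraph G" and "coboundary G U \<noteq> {}"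
  shows "disconnecting G (coboundary G U)"
proof -
  obtain e u v where e: "e \<in> coboundary G U" "ends G e = {u, v}" "u \<in> U" "v \<notin> U"
    using assms unfolding coboundary_def by blast
  have "(x \<in> U) = (y \<in> U)" if "(x, y) \<in> connected_via G (edges G - coboundary G U)" for x y
    by (rule connected_via_invariant[OF _ that]) (auto simp: in_coboundary_iff)
  then have "(u, v) \<notin> connected_via G (edges G - coboundary G U)" using e by blast
  then show ?thesis
    using e by (subst disconnecting_iff[OF G]) (auto simp: coboundary_def)
qed

text \<open>Let \<open>U\<close> be the component, after deleting \<open>C\<close>, of one end of a
  separated edge. Every edge leaving \<open>U\<close> lies in \<open>C\<close>, and these edges
  alone already disconnect, so minimality gives equality.\<close>

lemma minimal_cutset_coboundary:
  assumes G: "finite_multigraph G" and C: "minimal_cutset G C"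
  obtains U where "C = coboundary G U"
proof -
  have dC: "disconnecting G C" and CE: "C \<subseteq> edges G"
    using C by (auto simp: minimal_cutset_def disconnecting_def)
  let ?r = "connected_via G (edges G - C)"
  obtain e u v where e: "e \<in> C" "ends G e = {u, v}" "(u, v) \<notin> ?r"
    using dC disconnecting_iff[OF G CE] by blast
  have u: "u \<in> verts G" using G e CE unfolding finite_multigraph_def by blast
  let ?U = "?r `` {u}"
  have "u \<in> ?U" by (rule equiv_class_self[OF equiv_connected_via u])
  then have eU: "e \<in> coboundary G ?U"
    using e CE in_coboundary_iff[of e G u v ?U] by blast
  have "coboundary G ?U \<subseteq> C"
  proof
    fix f assume f: "f \<in> coboundary G ?U"
    then obtain x y where xy: "f \<in> edges G" "ends G f = {x, y}" "x \<in> ?U" "y \<notin> ?U"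
      by (auto simp: coboundary_def)
    show "f \<in> C"
    proof (rule ccontr)
      assume "f \<notin> C"
      then have "(x, y) \<in> ?r" using xy connected_via_edge[OF G, of f "edges G - C"] by auto
      then show False using xy equiv_connected_via[of G "edges G - C"]
        by (auto simp: equiv_def dest: transD)
    qed
  qed
  moreover have "disconnecting G (coboundary G ?U)"
    using disconnecting_coboundary[OF G] eU by blast
  ultimately have "C = coboundary G ?U"
    using C by (auto simp: minimal_cutset_def)
  then show thesis by (rule that)
qed

section \<open>Assembling and peeling disjoint unions\<close>

lemma disjoint_union_of_insert:
  assumes "Q C" "C \<subseteq> S" "disjoint_union_of Q (S - C)"
  shows "disjoint_union_of Q S"
proof -
  obtain F where F: "\<forall>C\<in>F. Q C" "disjoint F" "S - C = \<Union>F"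
    using assms(3) by (auto simp: disjoint_union_of_def)
  have "disjoint (insert C F)"
    using F by (auto simp: disjoint_def)
  moreover have "S = \<Union>(insert C F)" using F assms by auto
  ultimately show ?thesis
    using F(1) assms(1) unfolding disjoint_union_of_def by (intro exI[of _ "insert C F"]) auto
qed

lemma disjoint_union_of_empty: "disjoint_union_of Q {}"
  unfolding disjoint_union_of_def by (rule exI[of _ "{}"]) auto

lemma disjoint_union_of_induct [consumes 2, case_names empty step]:
  assumes "finite S" "disjoint_union_of Q S" "P {}"
    and step: "\<And>C T. Q C \<Longrightarrow> C \<subseteq> S \<Longrightarrow> T \<subseteq> S \<Longrightarrow> C \<inter> T = {} \<Longrightarrow> P T \<Longrightarrow> P (C \<union> T)"
  shows "P S"
proof -
  obtain F where F: "\<forall>C\<in>F. Q C" "disjoint F" "S = \<Union>F"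
    using assms(2) by (auto simp: disjoint_union_of_def)
  have "finite F" using F assms(1) finite_UnionD by auto
  then have "P (\<Union>F')" if "F' \<subseteq> F" for F'
  proof -
    have "finite F'" using that \<open>finite F\<close> finite_subset by blast
    then show ?thesis using that
    proof (induction F')
      case (insert C F')
      have "C \<inter> \<Union>F' = {}"
        using insert disjointD[OF F(2), of C] by auto
      then show ?case
        using insert F step[of C "\<Union>F'"] by auto
    qed (use assms in auto)
  qed
  then show ?thesis using F by auto
qed

text \<open>For disjoint sets, union is symmetric difference, so linearity gives one direction.
  Conversely a nonempty coboundary disconnects, hence contains a minimal cutset \<open>C\<close>;
  then \<open>S - C\<close> is a smaller coboundary.\<close>

lemma disjoint_union_minimal_cutsets_iff:
  assumes G: "finite_multigraph G" and S: "S \<subseteq> edges G"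
  shows "disjoint_union_of (minimal_cutset G) S \<longleftrightarrow> (\<exists>U. S = coboundary G U)"
proof
  have finE: "finite (edges G)" using G by (simp add: finite_multigraph_def)
  show "\<exists>U. S = coboundary G U" if "disjoint_union_of (minimal_cutset G) S"
    using finite_subset[OF S finE] that
  proof (induction rule: disjoint_union_of_induct)
    case empty
    have "{} = coboundary G {}" by (auto simp: coboundary_def)
    then show ?case by blast
  next
    case (step C T)
    obtain U W where "C = coboundary G U" "T = coboundary G W"
      using minimal_cutset_coboundary[OF G step(1)] step by metis
    then have "C \<union> T = coboundary G (sym_diff U W)"
      using coboundary_sym_diff[OF G, of U W] step(4) by auto
    then show ?case by blast
  qed
  assume "\<exists>U. S = coboundary G U"
  with finite_subset[OF S finE] show "disjoint_union_of (minimal_cutset G) S" using S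
  proof (induction S rule: finite_psubset_induct)
    case (psubset S)
    show ?case
    proof (cases "S = {}")
      case False
      then have dS: "disconnecting G S" using psubset disconnecting_coboundary[OF G] by blast
      obtain C where C: "C \<subseteq> S" "disconnecting G C" "\<And>D. D \<subset> C \<Longrightarrow> \<not> disconnecting G D"
      proof -
        obtain C where "C \<in> {C. C \<subseteq> S \<and> disconnecting G C}"
          "\<And>D. D \<in> {C. C \<subseteq> S \<and> disconnecting G C} \<Longrightarrow> D \<subseteq> C \<Longrightarrow> C = D"
          using finite_has_minimal[of "{C. C \<subseteq> S \<and> disconnecting G C}"] psubset(1) dS by auto
        then show thesis using that[of C] by blast
      qed
      then have mC: "minimal_cutset G C" by (auto simp: minimal_cutset_def)
      obtain U W where UW: "S = coboundary G U" "C = coboundary G W"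
        using minimal_cutset_coboundary[OF G mC] psubset by metis
      have "S - C = coboundary G (sym_diff U W)"
        using coboundary_sym_diff[OF G, of U W] UW C by auto
      moreover have "S - C \<subset> S" using C mC by (auto simp: minimal_cutset_def disconnecting_def)
      ultimately have "disjoint_union_of (minimal_cutset G) (S - C)"
        using psubset by blast
      then show ?thesis using disjoint_union_of_insert mC C by metis
    qed (simp add: disjoint_union_of_empty)
  qed
qed

subsection \<open>The chromatic polynomial\<close>

text \<open>A nonzero difference has finitely many roots. Positive arguments are the ones available
  for flows, as they are orders of groups.\<close>

lemma int_poly_eqI:
  fixes p q :: "int poly"
  assumes "\<And>n. n > 0 \<Longrightarrow> poly p (int n) = poly q (int n)"
  shows "p = q"
proof (rule ccontr)
  assume "p \<noteq> q"
  then have "finite {x. poly (p - q) x = 0}" by (intro poly_roots_finite) simp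
  moreover have "int ` {0<..} \<subseteq> {x. poly (p - q) x = 0}" using assms by auto
  ultimately have "finite (int ` {0<..})" by (rule rev_finite_subset)
  then have "finite {0::nat<..}" by (rule finite_imageD) simp
  then show False using infinite_Ioi by blast
qed

definition constant_on_edges :: "('v, 'e) multigraph \<Rightarrow> 'e set \<Rightarrow> ('v \<Rightarrow> 'a) \<Rightarrow> bool" where
  "constant_on_edges G S f \<longleftrightarrow> (\<forall>e\<in>S. \<forall>u v. ends G e = {u, v} \<longrightarrow> f u = f v)"

lemma card_constant_on_edges:
  fixes G :: "('v, 'e) multigraph"
  assumes G: "finite_multigraph G" and S: "S \<subseteq> edges G"
  shows "card {f \<in> verts G \<rightarrow>\<^sub>E {..<n}. constant_on_edges G S f} = n ^ num_components G S"
proof -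
  have "constant_on_edges G S f \<longleftrightarrow> (\<forall>(x, y)\<in>connected_via G S. f x = f y)" for f :: "'v \<Rightarrow> nat"
    unfolding constant_on_edges_def
    using connected_via_edge[OF G _ S] connected_via_invariant[of S G f] by blast
  then show ?thesis
    using card_respecting_functions[OF _ equiv_connected_via[of G S], where B = "{..<n}"] G
    by (simp add: num_components_def finite_multigraph_def)
qed

text \<open>Whitney's subset expansion: the indicator of properness is the product over the edges of
  1 minus the indicator of being monochromatic. Multiplying out gives a signed sum over
  \<open>S\<close>, whose inner counts are powers of \<open>n\<close>.\<close>

lemma proper_colourings_eq_poly:
  fixes G :: "('v, 'e) multigraph"
  assumes G: "finite_multigraph G"
  shows "int (card (proper_colourings G n)) =
    poly (\<Sum>S\<in>Pow (edges G). monom ((-1) ^ card S) (num_components G S)) (int n)"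
proof -
  have fin: "finite (verts G)" "finite (edges G)" using G by (auto simp: finite_multigraph_def)
  let ?F = "verts G \<rightarrow>\<^sub>E {..<n}"
  have finF: "finite ?F" using fin by (intro finite_PiE) auto
  \<comment> \<open>The universal statement and the negated one match because an edge has a pair of
    ends, unique up to order.\<close>
  have proper: "(\<forall>u v. ends G e = {u, v} \<longrightarrow> f u \<noteq> f v) \<longleftrightarrow> \<not> constant_on_edges G {e} f"
    if e: "e \<in> edges G" for e and f :: "'v \<Rightarrow> nat"
  proof -
    obtain x y where "ends G e = {x, y}" using ends_cases[OF G e] .
    then have "ends G e = {u, v} \<longleftrightarrow> u = x \<and> v = y \<or> u = y \<and> v = x" for u v
      by (auto simp: doubleton_eq_iff)
    then show ?thesis by (simp add: constant_on_edges_def) metis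
  qed
  have const: "(\<Prod>e\<in>S. - of_bool (constant_on_edges G {e} f)) =
      (-1) ^ card S * (of_bool (constant_on_edges G S f) :: int)"
    if "S \<in> Pow (edges G)" for S and f :: "'v \<Rightarrow> nat"
  proof -
    have "finite S" using that fin by (auto intro: finite_subset)
    then show ?thesis
      by (induction S) (auto simp: constant_on_edges_def)
  qed
  have "int (card (proper_colourings G n)) =
      (\<Sum>f\<in>?F. of_bool (\<forall>e\<in>edges G. \<not> constant_on_edges G {e} f))"
    unfolding proper_colourings_def using finF proper by (simp add: Int_def cong: conj_cong)
  also have "\<dots> = (\<Sum>f\<in>?F. \<Prod>e\<in>edges G. (- of_bool (constant_on_edges G {e} f) + 1))"
  proof (rule sum.cong)
    fix f :: "'v \<Rightarrow> nat"
    have "of_bool (\<forall>e\<in>S. \<not> constant_on_edges G {e} f) =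
        (\<Prod>e\<in>S. (- of_bool (constant_on_edges G {e} f) + (1 :: int)))" if "finite S" for S
      using that by (induction S) auto
    then show "of_bool (\<forall>e\<in>edges G. \<not> constant_on_edges G {e} f) =
        (\<Prod>e\<in>edges G. (- of_bool (constant_on_edges G {e} f) + (1 :: int)))"
      using fin(2) .
  qed simp
  also have "\<dots> = (\<Sum>f\<in>?F. \<Sum>S\<in>Pow (edges G). (-1) ^ card S * of_bool (constant_on_edges G S f))"
    unfolding prod_add[OF fin(2)]
    by (intro sum.cong refl) (simp only: const prod.neutral_const mult_1_right)
  also have "\<dots> = (\<Sum>S\<in>Pow (edges G). (-1) ^ card S * int (card {f \<in> ?F. constant_on_edges G S f}))"
    using finF by (subst sum.swap) (simp add: Int_def flip: sum_distrib_left)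
  also have "\<dots> = poly (\<Sum>S\<in>Pow (edges G). monom ((-1) ^ card S) (num_components G S)) (int n)"
    using card_constant_on_edges[OF G] by (simp add: poly_sum poly_monom)
  finally show ?thesis .
qed

lemma poly_chromatic_poly:
  assumes "finite_multigraph G"
  shows "poly (chromatic_poly G) (int n) = int (card (proper_colourings G n))"
proof -
  have "\<exists>!p. \<forall>n. poly p (int n) = int (card (proper_colourings G n))"
    by (intro ex_ex1I) (use proper_colourings_eq_poly[OF assms] int_poly_eqI in metis)+
  from theI'[OF this] show ?thesis unfolding chromatic_poly_def by simp
qed

text \<open>Adding a fixed proper 2-colouring modulo 2 exchanges proper 2-colourings with
  functions that are constant on components.\<close>
lemma card_proper_2_colourings:
  fixes G :: "('v, 'e) multigraph"
  assumes G: "finite_multigraph G" and U: "edges G = coboundary G U"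
  shows "card (proper_colourings G 2) = 2 ^ num_components G (edges G)"
proof -
  define \<phi> :: "('v \<Rightarrow> nat) \<Rightarrow> 'v \<Rightarrow> nat" where
    "\<phi> f = (\<lambda>v\<in>verts G. (f v + of_bool (v \<in> U)) mod 2)" for f
  let ?F = "{f \<in> verts G \<rightarrow>\<^sub>E {..<2::nat}. constant_on_edges G (edges G) f}"
  have inv: "\<phi> (\<phi> f) = f" if "f \<in> verts G \<rightarrow>\<^sub>E {..<2::nat}" for f
  proof (rule extensionalityI[of _ "verts G"])
    fix v assume v: "v \<in> verts G"
    then have "f v < 2" using that by auto
    then show "\<phi> (\<phi> f) v = f v" using v by (auto simp: \<phi>_def less_2_cases_iff)
  qed (use that in \<open>auto simp: \<phi>_def PiE_def\<close>)
  have range: "\<phi> f \<in> verts G \<rightarrow>\<^sub>E {..<2}" for f by (auto simp: \<phi>_def)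
  have key: "\<phi> f u = \<phi> f v \<longleftrightarrow> f u \<noteq> f v"
    if "f \<in> verts G \<rightarrow>\<^sub>E {..<2}" "e \<in> edges G" "ends G e = {u, v}" for f e u v
  proof -
    have uv: "u \<in> verts G" "v \<in> verts G" using that G by (auto simp: finite_multigraph_def)
    have "(u \<in> U) \<noteq> (v \<in> U)" using in_coboundary_iff[of e G u v U] that U by simp
    moreover have "f u < 2" "f v < 2" using uv that(1) by auto
    ultimately show ?thesis using uv by (auto simp: \<phi>_def less_2_cases_iff)
  qed
  have key': "\<phi> f u \<noteq> \<phi> f v \<longleftrightarrow> f u = f v"
    if "f \<in> verts G \<rightarrow>\<^sub>E {..<2}" "e \<in> edges G" "ends G e = {u, v}" for f e u v
    using key[OF that] by blast
  have "bij_betw \<phi> (proper_colourings G 2) ?F"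
    by (rule bij_betw_byWitness[where f' = \<phi>])
      (use inv range key key' in \<open>auto simp: proper_colourings_def constant_on_edges_def\<close>)
  then show ?thesis
    using card_constant_on_edges[OF G order.refl, of 2] by (simp add: bij_betw_same_card)
qed

lemma proper_2_colouring_coboundary:
  assumes G: "finite_multigraph G" and f: "f \<in> proper_colourings G 2"
  shows "edges G = coboundary G {v. f v = 0}"
proof -
  have "e \<in> coboundary G {v. f v = 0}" if e: "e \<in> edges G" for e
  proof -
    obtain u v where uv: "ends G e = {u, v}" "u \<in> verts G" "v \<in> verts G" using ends_cases[OF G e] .
    moreover have "f u \<noteq> f v" using e f uv by (auto simp: proper_colourings_def)
    moreover have "f u < 2" "f v < 2" using f uv by (auto simp: proper_colourings_def)
    ultimately have "(f u = 0) \<noteq> (f v = 0)" by linarith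
    then show ?thesis using e uv by (simp add: in_coboundary_iff)
  qed
  then show ?thesis by (auto simp: coboundary_def)
qed

text \<open>The power of 2 found here is what the \<open>- c\<close> in the exponent of the theorem
  compensates.\<close>

lemma chromatic_poly_2:
  assumes G: "finite_multigraph G"
  shows "poly (chromatic_poly G) 2 =
    (if disjoint_union_of (minimal_cutset G) (edges G) then 2 ^ num_components G (edges G) else 0)"
proof (cases "proper_colourings G 2 = {}")
  case True
  then have "\<not> disjoint_union_of (minimal_cutset G) (edges G)"
    using card_proper_2_colourings[OF G] disjoint_union_minimal_cutsets_iff[OF G order.refl] by auto
  then show ?thesis using True poly_chromatic_poly[OF G, of 2] by simp
next
  case False
  then obtain U where U: "edges G = coboundary G U"
    using proper_2_colouring_coboundary[OF G] by blast
  then have "disjoint_union_of (minimal_cutset G) (edges G)"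
    using disjoint_union_minimal_cutsets_iff[OF G order.refl] by blast
  then show ?thesis using card_proper_2_colourings[OF G U] poly_chromatic_poly[OF G, of 2] by simp
qed

subsection \<open>The flow polynomial\<close>

text \<open>With conservation demanded at every element of the type, contracting an edge amounts to
  composing tail and head maps with a map that identifies its endpoints; no vertex set changes.\<close>
definition nowhere_zero_flows_on ::
    "'e set \<Rightarrow> ('e \<Rightarrow> 'v) \<Rightarrow> ('e \<Rightarrow> 'v) \<Rightarrow> ('h, 'b) monoid_scheme \<Rightarrow> ('e \<Rightarrow> 'h) set" where
  "nowhere_zero_flows_on E t h H = {f \<in> E \<rightarrow>\<^sub>E (carrier H - {\<one>\<^bsub>H\<^esub>}).
     \<forall>v. finprod H f {e \<in> E. t e = v} = finprod H f {e \<in> E. h e = v}}"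

text \<open>Outside \<open>verts G\<close> no edge starts or ends, so conservation there equates two
  empty products.\<close>

lemma nowhere_zero_flows_eq:
  assumes G: "finite_multigraph G" and o: "orientation G t h"
  shows "nowhere_zero_flows G t h H = nowhere_zero_flows_on (edges G) t h H"
proof -
  have *: "{e \<in> edges G. t e = v} = {}" "{e \<in> edges G. h e = v} = {}" if "v \<notin> verts G" for v
    using G o that by (auto simp: finite_multigraph_def orientation_def)
  have "finprod H f {e \<in> edges G. t e = v} = finprod H f {e \<in> edges G. h e = v}"
    if "v \<notin> verts G" for v f by (simp only: *[OF that])
  then show ?thesis
    unfolding nowhere_zero_flows_def nowhere_zero_flows_on_def by blast
qed

lemma finite_nowhere_zero_flows_on:
  assumes "finite E" "finite (carrier H)"
  shows "finite (nowhere_zero_flows_on E t h H)"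
  unfolding nowhere_zero_flows_on_def
  by (rule finite_subset[of _ "E \<rightarrow>\<^sub>E carrier H"]) (use assms in \<open>auto intro!: finite_PiE\<close>)

lemma fibre_insert:
  "{x \<in> insert e E. t x = v} = (if t e = v then insert e {x \<in> E. t x = v} else {x \<in> E. t x = v})"
  by auto

lemma (in comm_monoid) finprod_fibre_insert:
  assumes "finite E" "e \<notin> E" "f \<in> insert e E \<rightarrow> carrier G"
  shows "finprod G f {x \<in> insert e E. t x = v} =
    (if t e = v then f e \<otimes> finprod G f {x \<in> E. t x = v} else finprod G f {x \<in> E. t x = v})"
  unfolding fibre_insert using assms by (auto simp: Pi_iff)

lemma (in comm_monoid) finprod_fibre_upd:
  assumes "e \<notin> E" "f \<in> E \<rightarrow> carrier G"
  shows "finprod G (f(e := x)) {x \<in> E. t x = v} = finprod G f {x \<in> E. t x = v}"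
  using assms by (intro finprod_cong') auto

lemma (in comm_monoid) finprod_fibre_restrict:
  assumes "f \<in> E \<rightarrow> carrier G"
  shows "finprod G (restrict f E) {x \<in> E. t x = v} = finprod G f {x \<in> E. t x = v}"
  using assms by (intro finprod_cong') auto

text \<open>The value on a loop enters both sides of the law at its vertex and cancels, so it ranges
  freely over the nontrivial elements.\<close>

lemma card_flows_loop:
  assumes H: "comm_group H" and fin: "finite (carrier H)" "finite E"
    and e: "e \<notin> E" "t e = h e"
  shows "card (nowhere_zero_flows_on (insert e E) t h H) =
    (card (carrier H) - 1) * card (nowhere_zero_flows_on E t h H)"
proof -
  interpret comm_group H by fact
  let ?X = "(carrier H - {\<one>\<^bsub>H\<^esub>}) \<times> nowhere_zero_flows_on E t h H"
  have "bij_betw (\<lambda>(x, f). f(e := x)) ?X (nowhere_zero_flows_on (insert e E) t h H)"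
  proof (rule bij_betw_byWitness[where f' = "\<lambda>f. (f e, restrict f E)"])
    show "\<forall>p\<in>?X. (\<lambda>f. (f e, restrict f E)) ((\<lambda>(x, f). f(e := x)) p) = p"
    proof
      fix p assume "p \<in> ?X"
      then obtain x f where p: "p = (x, f)" and f: "f \<in> nowhere_zero_flows_on E t h H" by auto
      then have "f \<in> extensional E" by (auto simp: nowhere_zero_flows_on_def PiE_def)
      then have "restrict (f(e := x)) E = f"
        using e by (intro extensionalityI[of _ E]) auto
      then show "(\<lambda>f. (f e, restrict f E)) ((\<lambda>(x, f). f(e := x)) p) = p" by (simp add: p)
    qed
    show "\<forall>f\<in>nowhere_zero_flows_on (insert e E) t h H. (\<lambda>(x, f). f(e := x)) (f e, restrict f E) = f"
    proof
      fix f assume "f \<in> nowhere_zero_flows_on (insert e E) t h H"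
      then have "f \<in> extensional (insert e E)" by (auto simp: nowhere_zero_flows_on_def PiE_def)
      then have "(restrict f E)(e := f e) = f"
        by (intro extensionalityI[of _ "insert e E"]) (auto simp: extensional_def)
      then show "(\<lambda>(x, f). f(e := x)) (f e, restrict f E) = f" by simp
    qed
    show "(\<lambda>(x, f). f(e := x)) ` ?X \<subseteq> nowhere_zero_flows_on (insert e E) t h H"
    proof (rule image_subsetI)
      fix p assume "p \<in> ?X"
      then obtain x f where p: "p = (x, f)" and x: "x \<in> carrier H" "x \<noteq> \<one>\<^bsub>H\<^esub>"
        and f: "f \<in> nowhere_zero_flows_on E t h H" by auto
      have fE: "f \<in> E \<rightarrow> carrier H" using f by (auto simp: nowhere_zero_flows_on_def)
      have fe: "f(e := x) \<in> insert e E \<rightarrow> carrier H" using fE x by auto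
      have "f(e := x) \<in> insert e E \<rightarrow>\<^sub>E (carrier H - {\<one>\<^bsub>H\<^esub>})"
        using f x by (auto simp: nowhere_zero_flows_on_def PiE_def extensional_def split: if_splits)
      then have "f(e := x) \<in> nowhere_zero_flows_on (insert e E) t h H"
        using f e unfolding nowhere_zero_flows_on_def mem_Collect_eq
          finprod_fibre_insert[OF fin(2) e(1) fe] finprod_fibre_upd[OF e(1) fE] by simp
      then show "(\<lambda>(x, f). f(e := x)) p \<in> nowhere_zero_flows_on (insert e E) t h H" by (simp add: p)
    qed
    show "(\<lambda>f. (f e, restrict f E)) ` nowhere_zero_flows_on (insert e E) t h H \<subseteq> ?X"
    proof (rule image_subsetI)
      fix f assume f: "f \<in> nowhere_zero_flows_on (insert e E) t h H"
      have fe: "f \<in> insert e E \<rightarrow> carrier H" using f by (auto simp: nowhere_zero_flows_on_def)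
      then have fE: "f \<in> E \<rightarrow> carrier H" by auto
      have "finprod H f {x \<in> E. t x = v} = finprod H f {x \<in> E. h x = v}" for v
      proof -
        have "finprod H f {x \<in> insert e E. t x = v} = finprod H f {x \<in> insert e E. h x = v}"
          using f unfolding nowhere_zero_flows_on_def by blast
        then show ?thesis
          unfolding finprod_fibre_insert[OF fin(2) e(1) fe]
          using e(2) fe fE by (auto split: if_splits simp: Pi_iff)
      qed
      then show "(f e, restrict f E) \<in> ?X"
        using f by (auto simp: nowhere_zero_flows_on_def finprod_fibre_restrict[OF fE])
    qed
  qed
  then have "card (nowhere_zero_flows_on (insert e E) t h H) = card ?X"
    by (simp add: bij_betw_same_card)
  then show ?thesis using fin by (simp add: card_cartesian_product)
qed

text \<open>A flow of the contraction determines the value that the contracted edge must carry;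
  this value is trivial exactly if deleting the edge leaves a flow.\<close>
lemma card_flows_contract:
  fixes \<pi> :: "'v \<Rightarrow> 'w" and E :: "'e set"
  assumes H: "comm_group H" and fin: "finite (carrier H)" "finite E"
    and e: "e \<notin> E" "t e = a" "h e = b" "a \<noteq> b"
    and \<pi>: "\<And>v w. \<pi> v = \<pi> w \<longleftrightarrow> v = w \<or> {v, w} = {a, b}"
  shows "card (nowhere_zero_flows_on (insert e E) t h H) + card (nowhere_zero_flows_on E t h H) =
    card (nowhere_zero_flows_on E (\<pi> \<circ> t) (\<pi> \<circ> h) H)"
proof -
  interpret comm_group H by fact
  define T where "T f v = finprod H f {x \<in> E. t x = v}" for f v
  define B where "B f v = finprod H f {x \<in> E. h x = v}" for f v
  \<comment> \<open>Conservation at the head \<open>b\<close> of \<open>e\<close> says that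
    \<open>T f b\<close> is the value of \<open>e\<close> times \<open>B f b\<close>; solved for
    that value.\<close>
  define val where "val f = T f b \<otimes>\<^bsub>H\<^esub> inv\<^bsub>H\<^esub> B f b" for f
  have closed: "T f v \<in> carrier H" "B f v \<in> carrier H" if "f \<in> E \<rightarrow> carrier H" for f v
    using that by (auto simp: T_def B_def intro!: finprod_closed)
  let ?N = "\<lambda>f. f \<in> E \<rightarrow>\<^sub>E (carrier H - {\<one>\<^bsub>H\<^esub>})"
  have merge: "finprod H f {x \<in> E. \<pi> (s x) = \<pi> v} =
      (if v = a \<or> v = b then finprod H f {x \<in> E. s x = a} \<otimes>\<^bsub>H\<^esub> finprod H f {x \<in> E. s x = b}
       else finprod H f {x \<in> E. s x = v})" if f: "f \<in> E \<rightarrow> carrier H" for f s v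
  proof (cases "v = a \<or> v = b")
    case True
    then have "{x \<in> E. \<pi> (s x) = \<pi> v} = {x \<in> E. s x = a} \<union> {x \<in> E. s x = b}"
      by (auto simp: \<pi> doubleton_eq_iff)
    moreover have "finprod H f ({x \<in> E. s x = a} \<union> {x \<in> E. s x = b}) =
        finprod H f {x \<in> E. s x = a} \<otimes>\<^bsub>H\<^esub> finprod H f {x \<in> E. s x = b}"
      using fin f e(4) by (intro finprod_Un_disjoint) auto
    ultimately show ?thesis using True by simp
  next
    case False
    then have "{x \<in> E. \<pi> (s x) = \<pi> v} = {x \<in> E. s x = v}"
      by (auto simp: \<pi> doubleton_eq_iff)
    then show ?thesis using False by simp
  qed
  have contracted: "f \<in> nowhere_zero_flows_on E (\<pi> \<circ> t) (\<pi> \<circ> h) H \<longleftrightarrow>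
      ?N f \<and> (\<forall>v. v \<noteq> a \<and> v \<noteq> b \<longrightarrow> T f v = B f v) \<and>
      T f a \<otimes>\<^bsub>H\<^esub> T f b = B f a \<otimes>\<^bsub>H\<^esub> B f b" (is "_ \<longleftrightarrow> _ \<and> ?C f") for f
  proof (cases "?N f")
    case True
    then have f: "f \<in> E \<rightarrow> carrier H" by auto
    \<comment> \<open>Off the range of \<open>\<pi>\<close> both products are empty, so only points
      of the form \<open>\<pi> v\<close> matter.\<close>
    have "(\<forall>w. finprod H f {x \<in> E. \<pi> (t x) = w} = finprod H f {x \<in> E. \<pi> (h x) = w}) \<longleftrightarrow>
        (\<forall>v. finprod H f {x \<in> E. \<pi> (t x) = \<pi> v} = finprod H f {x \<in> E. \<pi> (h x) = \<pi> v})"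
      (is "?L \<longleftrightarrow> ?R")
    proof
      assume R: ?R
      show ?L
      proof
        fix w
        show "finprod H f {x \<in> E. \<pi> (t x) = w} = finprod H f {x \<in> E. \<pi> (h x) = w}"
        proof (cases "w \<in> range \<pi>")
          case False
          then have "{x \<in> E. \<pi> (t x) = w} = {}" "{x \<in> E. \<pi> (h x) = w} = {}" by auto
          then show ?thesis by metis
        qed (use R in auto)
      qed
    qed auto
    also have "\<dots> \<longleftrightarrow> ?C f"
      unfolding merge[OF f] T_def B_def using e(4) by auto
    finally show ?thesis using True by (simp add: nowhere_zero_flows_on_def)
  qed (simp add: nowhere_zero_flows_on_def)
  have deleted: "f \<in> nowhere_zero_flows_on E t h H \<longleftrightarrow> ?N f \<and> (\<forall>v. T f v = B f v)" for f
    by (simp add: nowhere_zero_flows_on_def T_def B_def)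
  have full: "f \<in> nowhere_zero_flows_on (insert e E) t h H \<longleftrightarrow>
      f \<in> insert e E \<rightarrow>\<^sub>E (carrier H - {\<one>\<^bsub>H\<^esub>}) \<and> (\<forall>v. v \<noteq> a \<and> v \<noteq> b \<longrightarrow> T f v = B f v) \<and>
      f e \<otimes>\<^bsub>H\<^esub> T f a = B f a \<and> T f b = f e \<otimes>\<^bsub>H\<^esub> B f b" for f
  proof (cases "f \<in> insert e E \<rightarrow>\<^sub>E (carrier H - {\<one>\<^bsub>H\<^esub>})")
    case True
    then have fe: "f \<in> insert e E \<rightarrow> carrier H" by auto
    have "(\<forall>v. (if a = v then f e \<otimes>\<^bsub>H\<^esub> T f v else T f v) = (if b = v then f e \<otimes>\<^bsub>H\<^esub> B f v else B f v)) \<longleftrightarrow>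
        (\<forall>v. v \<noteq> a \<and> v \<noteq> b \<longrightarrow> T f v = B f v) \<and>
        f e \<otimes>\<^bsub>H\<^esub> T f a = B f a \<and> T f b = f e \<otimes>\<^bsub>H\<^esub> B f b" (is "?l \<longleftrightarrow> ?r")
    proof
      assume l: ?l
      have "T f v = B f v" if "v \<noteq> a" "v \<noteq> b" for v using l[rule_format, of v] that by simp
      then show ?r using e(4) l[rule_format, of a] l[rule_format, of b] by simp
    qed (use e(4) in auto)
    then show ?thesis
      unfolding nowhere_zero_flows_on_def mem_Collect_eq
        finprod_fibre_insert[OF fin(2) e(1) fe] e(2,3) T_def B_def by blast
  qed (simp add: nowhere_zero_flows_on_def)
  \<comment> \<open>Once the law at \<open>b\<close> holds, multiplying the law at \<open>a\<close>
    by \<open>B f b\<close> turns it into the law at the merged vertex, and cancellation reverses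
    this.\<close>
  have solve: "x \<otimes>\<^bsub>H\<^esub> T f a = B f a \<and> T f b = x \<otimes>\<^bsub>H\<^esub> B f b \<longleftrightarrow>
      T f a \<otimes>\<^bsub>H\<^esub> T f b = B f a \<otimes>\<^bsub>H\<^esub> B f b \<and> x = val f"
    if f: "f \<in> E \<rightarrow> carrier H" and x: "x \<in> carrier H" for f x
  proof -
    note c = closed[OF f]
    have "T f b = x \<otimes>\<^bsub>H\<^esub> B f b \<longleftrightarrow> x = val f"
      unfolding val_def using c x by (metis inv_closed inv_solve_right)
    moreover have "x \<otimes>\<^bsub>H\<^esub> T f a = B f a \<longleftrightarrow> T f a \<otimes>\<^bsub>H\<^esub> T f b = B f a \<otimes>\<^bsub>H\<^esub> B f b"
      if "T f b = x \<otimes>\<^bsub>H\<^esub> B f b"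
    proof -
      have "T f a \<otimes>\<^bsub>H\<^esub> T f b = (x \<otimes>\<^bsub>H\<^esub> T f a) \<otimes>\<^bsub>H\<^esub> B f b"
        using c x that by (simp add: m_ac)
      then show ?thesis using c x by simp
    qed
    ultimately show ?thesis by blast
  qed
  have val_closed: "val f \<in> carrier H" if "f \<in> E \<rightarrow> carrier H" for f
    using closed[OF that] by (simp add: val_def)
  have upd: "T (f(e := x)) v = T f v" "B (f(e := x)) v = B f v" if "f \<in> E \<rightarrow> carrier H" for f x v
    using finprod_fibre_upd[OF e(1) that] by (simp_all add: T_def B_def)
  have restr: "T (restrict f E) v = T f v" "B (restrict f E) v = B f v" if "f \<in> E \<rightarrow> carrier H" for f v
    using finprod_fibre_restrict[OF that] by (simp_all add: T_def B_def)
  let ?K = "nowhere_zero_flows_on E (\<pi> \<circ> t) (\<pi> \<circ> h) H"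
  let ?M = "{f \<in> ?K. val f \<noteq> \<one>\<^bsub>H\<^esub>}"
  have del_eq: "nowhere_zero_flows_on E t h H = {f \<in> ?K. val f = \<one>\<^bsub>H\<^esub>}"
  proof -
    have "f \<in> nowhere_zero_flows_on E t h H \<longleftrightarrow> f \<in> ?K \<and> val f = \<one>\<^bsub>H\<^esub>" for f
    proof (cases "?N f")
      case True
      then have f: "f \<in> E \<rightarrow> carrier H" by auto
      have "T f a = B f a \<and> T f b = B f b \<longleftrightarrow>
          T f a \<otimes>\<^bsub>H\<^esub> T f b = B f a \<otimes>\<^bsub>H\<^esub> B f b \<and> val f = \<one>\<^bsub>H\<^esub>"
        using solve[OF f one_closed] closed[OF f] by auto
      moreover have "(\<forall>v. T f v = B f v) \<longleftrightarrow>
          (\<forall>v. v \<noteq> a \<and> v \<noteq> b \<longrightarrow> T f v = B f v) \<and> T f a = B f a \<and> T f b = B f b"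
        by auto
      ultimately show ?thesis unfolding deleted contracted by argo
    qed (simp add: nowhere_zero_flows_on_def)
    then show ?thesis by auto
  qed
  have "bij_betw (\<lambda>f. restrict f E) (nowhere_zero_flows_on (insert e E) t h H) ?M"
  proof (rule bij_betw_byWitness[where f' = "\<lambda>f. f(e := val f)"])
    show "\<forall>f\<in>nowhere_zero_flows_on (insert e E) t h H. (restrict f E)(e := val (restrict f E)) = f"
    proof
      fix f assume f: "f \<in> nowhere_zero_flows_on (insert e E) t h H"
      then have fx: "f \<in> insert e E \<rightarrow>\<^sub>E (carrier H - {\<one>\<^bsub>H\<^esub>})" by (simp add: full)
      then have fE: "f \<in> E \<rightarrow> carrier H" and x: "f e \<in> carrier H" by auto
      have "val (restrict f E) = f e"
        using f solve[OF fE x] restr[OF fE] by (simp add: full val_def)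
      then show "(restrict f E)(e := val (restrict f E)) = f"
        using fx by (intro extensionalityI[of _ "insert e E"]) (auto simp: extensional_def PiE_def)
    qed
    show "\<forall>f\<in>?M. restrict (f(e := val f)) E = f"
    proof
      fix f assume "f \<in> ?M"
      then have "f \<in> extensional E" by (auto simp: nowhere_zero_flows_on_def PiE_def)
      then show "restrict (f(e := val f)) E = f"
        using e by (intro extensionalityI[of _ E]) auto
    qed
    show "(\<lambda>f. restrict f E) ` nowhere_zero_flows_on (insert e E) t h H \<subseteq> ?M"
    proof (rule image_subsetI)
      fix f assume f: "f \<in> nowhere_zero_flows_on (insert e E) t h H"
      then have fx: "f \<in> insert e E \<rightarrow>\<^sub>E (carrier H - {\<one>\<^bsub>H\<^esub>})" by (simp add: full)
      then have fE: "f \<in> E \<rightarrow> carrier H" and x: "f e \<in> carrier H" "f e \<noteq> \<one>\<^bsub>H\<^esub>" by auto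
      have "?N (restrict f E)" using fx by auto
      then show "restrict f E \<in> ?M"
        using f solve[OF fE x(1)] x restr[OF fE] by (simp add: full contracted val_def)
    qed
    show "(\<lambda>f. f(e := val f)) ` ?M \<subseteq> nowhere_zero_flows_on (insert e E) t h H"
    proof (rule image_subsetI)
      fix f assume f: "f \<in> ?M"
      then have N: "?N f" by (simp add: contracted)
      then have fE: "f \<in> E \<rightarrow> carrier H" by auto
      have "f(e := val f) \<in> insert e E \<rightarrow>\<^sub>E (carrier H - {\<one>\<^bsub>H\<^esub>})"
        using N f val_closed[OF fE] by (auto simp: PiE_def extensional_def split: if_splits)
      then show "f(e := val f) \<in> nowhere_zero_flows_on (insert e E) t h H"
        using f solve[OF fE val_closed[OF fE]] by (simp add: full contracted upd[OF fE])
    qed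
  qed
  then have "card (nowhere_zero_flows_on (insert e E) t h H) = card ?M"
    by (rule bij_betw_same_card)
  moreover have "card ?K = card ?M + card {f \<in> ?K. val f = \<one>\<^bsub>H\<^esub>}"
  proof -
    have "?K = ?M \<union> {f \<in> ?K. val f = \<one>\<^bsub>H\<^esub>}" by auto
    then show ?thesis
      using finite_nowhere_zero_flows_on[OF fin(2,1), of "\<pi> \<circ> t" "\<pi> \<circ> h"]
      by (subst card_Un_disjoint[symmetric]) (auto intro: finite_subset)
  qed
  ultimately show ?thesis using del_eq by simp
qed

text \<open>The polynomial is quantified before orientation and group, as \<open>flow_poly\<close>
  requires. The end sets \<open>en\<close> vary in the induction because contraction replaces them
  by their images under \<open>\<pi>\<close>.\<close>

lemma card_flows_polynomial:
  fixes en :: "'e \<Rightarrow> 'v set"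
  assumes "finite E"
  shows "\<exists>p. \<forall>t h (H :: int monoid). (\<forall>e\<in>E. en e = {t e, h e}) \<longrightarrow> comm_group H \<longrightarrow>
    finite (carrier H) \<longrightarrow> poly p (int (card (carrier H))) = int (card (nowhere_zero_flows_on E t h H))"
  using assms
proof (induction E arbitrary: en)
  case empty
  have "nowhere_zero_flows_on {} t h H = {\<lambda>_. undefined}" for t h :: "'e \<Rightarrow> 'v" and H :: "int monoid"
    by (auto simp: nowhere_zero_flows_on_def)
  then show ?case by (intro exI[of _ 1]) simp
next
  case (insert e E)
  obtain p where p: "\<And>t h (H :: int monoid). (\<forall>e\<in>E. en e = {t e, h e}) \<Longrightarrow> comm_group H \<Longrightarrow>
      finite (carrier H) \<Longrightarrow> poly p (int (card (carrier H))) = int (card (nowhere_zero_flows_on E t h H))"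
    using insert.IH[of en] by blast
  consider a where "en e = {a}" | a b where "en e = {a, b}" "a \<noteq> b" | "\<nexists>a b. en e = {a, b}"
  proof (cases "\<exists>a b. en e = {a, b}")
    case True
    then obtain a b where "en e = {a, b}" by blast
    then show ?thesis using that(1)[of a] that(2)[of a b] by (cases "a = b") auto
  qed (use that(3) in blast)
  then show ?case
  proof cases
    case 1
    \<comment> \<open>The factor \<open>[:-1, 1:]\<close>, evaluated at the order of the group,
      counts the values a loop may carry.\<close>
    show ?thesis
    proof (intro exI[of _ "[:-1, 1:] * p"] allI impI)
      fix t h and H :: "int monoid"
      assume o: "\<forall>e\<in>insert e E. en e = {t e, h e}" and H: "comm_group H" "finite (carrier H)"
      interpret comm_group H by fact
      have "t e \<in> en e" "h e \<in> en e" using o by auto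
      then have "t e = h e" using 1 by simp
      moreover have "card (carrier H) > 0" using H(2) one_closed by (auto simp: card_gt_0_iff)
      ultimately show "poly ([:-1, 1:] * p) (int (card (carrier H))) =
          int (card (nowhere_zero_flows_on (insert e E) t h H))"
        using card_flows_loop[OF H insert(1,2), of t h] p[of t h H] o H
        by (simp add: of_nat_diff algebra_simps)
    qed
  next
    case 2
    define \<pi> where "\<pi> v = (if v = b then a else v)" for v
    have \<pi>: "\<pi> v = \<pi> w \<longleftrightarrow> v = w \<or> {v, w} = {a, b}" for v w
      using 2 by (auto simp: \<pi>_def doubleton_eq_iff)
    obtain q where q: "\<And>t h (H :: int monoid). (\<forall>e\<in>E. \<pi> ` en e = {t e, h e}) \<Longrightarrow> comm_group H \<Longrightarrow>
        finite (carrier H) \<Longrightarrow> poly q (int (card (carrier H))) = int (card (nowhere_zero_flows_on E t h H))"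
      using insert.IH[of "\<lambda>e. \<pi> ` en e"] by blast
    show ?thesis
    proof (intro exI[of _ "q - p"] allI impI)
      fix t h and H :: "int monoid"
      assume o: "\<forall>e\<in>insert e E. en e = {t e, h e}" and H: "comm_group H" "finite (carrier H)"
      have e: "{t e, h e} = {a, b}" using o 2 by auto
      then have "t e \<noteq> h e" using 2 by auto
      \<comment> \<open>The edge may point either way between \<open>a\<close> and \<open>b\<close>,
        so contraction is applied with \<open>t e\<close> and \<open>h e\<close>; the condition on
        \<open>\<pi>\<close> is symmetric in them.\<close>
      then have "card (nowhere_zero_flows_on (insert e E) t h H) + card (nowhere_zero_flows_on E t h H) =
          card (nowhere_zero_flows_on E (\<pi> \<circ> t) (\<pi> \<circ> h) H)"
        using card_flows_contract[OF H insert(1,2), of t "t e" h "h e" \<pi>] \<pi> e by simp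
      then show "poly (q - p) (int (card (carrier H))) =
          int (card (nowhere_zero_flows_on (insert e E) t h H))"
        using p[of t h H] q[of "\<pi> \<circ> t" "\<pi> \<circ> h" H] o H by simp
    qed
  next
    case 3
    \<comment> \<open>Such an edge admits no orientation, so the claim is vacuous.\<close>
    then show ?thesis by blast
  qed
qed

subsection \<open>Even degrees and cycles\<close>

text \<open>A loop counts twice, so that summing over edges gives the degree and a loop, being a
  cycle, keeps it even.\<close>

definition incidence :: "('v, 'e) multigraph \<Rightarrow> 'e \<Rightarrow> 'v \<Rightarrow> nat" where
  "incidence G e v = (if ends G e = {v} then 2 else of_bool (v \<in> ends G e))"

definition even_degrees :: "('v, 'e) multigraph \<Rightarrow> 'e set \<Rightarrow> bool" where
  "even_degrees G S \<longleftrightarrow> (\<forall>v. even (\<Sum>e\<in>S. incidence G e v))"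

lemma incidence_eq: "ends G e = {a, b} \<Longrightarrow> incidence G e v = of_bool (a = v) + of_bool (b = v)"
  by (auto simp: incidence_def)

lemma sum_cyclic_shift:
  fixes g :: "nat \<Rightarrow> 'a :: comm_monoid_add"
  shows "(\<Sum>i<n. g (Suc i mod n)) = (\<Sum>i<n. g i)"
proof (cases n)
  case (Suc m)
  have "(\<Sum>i<m. g (Suc i mod n)) = (\<Sum>i<m. g (Suc i))"
    by (rule sum.cong) (auto simp: Suc)
  then have "(\<Sum>i<n. g (Suc i mod n)) = (\<Sum>i<m. g (Suc i)) + g 0" by (simp add: Suc)
  also have "\<dots> = (\<Sum>i<n. g i)" by (simp add: Suc sum.lessThan_Suc_shift add.commute del: sum.lessThan_Suc)
  finally show ?thesis .
qed simp

text \<open>Each position on the cycle is an end of its own edge and of the preceding one; a cyclic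
  shift of the index makes the two contributions equal. Loops and parallel pairs need no separate
  case.\<close>

lemma even_degrees_cycle:
  assumes "cycle G C"
  shows "even_degrees G C"
  unfolding even_degrees_def
proof
  fix v
  obtain vs es where c: "distinct es" "set es = C"
    "\<And>i. i < length es \<Longrightarrow> ends G (es ! i) = {vs ! i, vs ! (Suc i mod length es)}"
    using assms by (auto simp: cycle_def)
  have "(\<Sum>e\<in>C. incidence G e v) = (\<Sum>i<length es. incidence G (es ! i) v)"
    using sum.reindex_bij_betw[OF bij_betw_nth[OF c(1) refl c(2)[symmetric]],
        of "\<lambda>e. incidence G e v"] by simp
  also have "\<dots> = (\<Sum>i<length es. of_bool (vs ! i = v) + of_bool (vs ! (Suc i mod length es) = v))"
    using incidence_eq[OF c(3)] by (intro sum.cong) auto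
  also have "\<dots> = 2 * (\<Sum>i<length es. of_bool (vs ! i = v))"
    using sum_cyclic_shift[of "\<lambda>i. of_bool (vs ! i = v) :: nat" "length es"]
    by (simp only: sum.distrib mult_2)
  finally show "even (\<Sum>e\<in>C. incidence G e v)" by simp
qed

text \<open>Walks grow at the head of the list.\<close>
definition edge_path :: "('v, 'e) multigraph \<Rightarrow> 'e set \<Rightarrow> 'v list \<Rightarrow> 'e list \<Rightarrow> bool" where
  "edge_path G S vs es \<longleftrightarrow> length vs = Suc (length es) \<and> distinct vs \<and> set vs \<subseteq> verts G \<and>
     set es \<subseteq> S \<and> (\<forall>i<length es. ends G (es ! i) = {vs ! i, vs ! Suc i}) \<and>
     (\<exists>e\<in>S. vs ! 0 \<in> ends G e)"

lemma edge_path_distinct_edges: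
  assumes "edge_path G S vs es"
  shows "distinct es"
  unfolding distinct_conv_nth
proof (intro allI impI)
  have ne: "es ! i \<noteq> es ! j" if "i < j" "j < length es" for i j
  proof
    assume "es ! i = es ! j"
    moreover have "ends G (es ! i) = {vs ! i, vs ! Suc i}" "ends G (es ! j) = {vs ! j, vs ! Suc j}"
      using assms that unfolding edge_path_def by (meson order.strict_trans)+
    ultimately have "vs ! i \<in> {vs ! j, vs ! Suc j}" by (metis insertI1)
    then show False
      using assms that by (auto simp: edge_path_def nth_eq_iff_index_eq)
  qed
  fix i j assume "i < length es" "j < length es" "i \<noteq> j"
  then show "es ! i \<noteq> es ! j" using ne[of i j] ne[of j i] by (cases i j rule: linorder_cases) auto
qed

text \<open>The edge \<open>e\<close> joins the head back to \<open>vs ! j\<close> and closes the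
  first \<open>j\<close> edges of the path; \<open>j = 0\<close> gives a loop. Distinctness of the
  vertices keeps \<open>e\<close> apart from all later edges of the path, and only
  \<open>es ! 0\<close> has to be excluded by hypothesis.\<close>

lemma edge_path_close:
  assumes S: "S \<subseteq> edges G" and p: "edge_path G S vs es"
    and e: "e \<in> S" "ends G e = {vs ! 0, vs ! j}" "j < length vs" "es \<noteq> [] \<Longrightarrow> e \<noteq> es ! 0"
  shows "\<exists>C\<subseteq>S. cycle G C"
proof -
  let ?es = "take j es @ [e]" and ?vs = "take (Suc j) vs"
  have len: "length ?vs = Suc j" "length ?es = Suc j" "j \<le> length es"
    using p e by (auto simp: edge_path_def)
  have pe: "ends G (es ! i) = {vs ! i, vs ! Suc i}" if "i < length es" for i
    using p that by (simp add: edge_path_def)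
  have "e \<noteq> es ! i" if "i < length es" for i
  proof (cases i)
    case 0
    then show ?thesis using that e(4) by auto
  next
    case (Suc k)
    have "vs ! 0 \<noteq> vs ! i" "vs ! 0 \<noteq> vs ! Suc i"
      using p that Suc by (simp_all add: edge_path_def nth_eq_iff_index_eq)
    then show ?thesis using pe[OF that] e(2) by auto
  qed
  then have "e \<notin> set es" by (metis in_set_conv_nth)
  then have "distinct ?es"
    using edge_path_distinct_edges[OF p] by (auto dest: in_set_takeD)
  moreover have "distinct ?vs" using p by (simp add: edge_path_def)
  moreover have "ends G (?es ! i) = {?vs ! i, ?vs ! (Suc i mod length ?es)}" if "i < length ?es" for i
  proof (cases "i = j")
    case True
    then show ?thesis using e(2) len by (auto simp: nth_append)
  next
    case False
    then have "i < j" using that len by simp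
    then show ?thesis using pe[of i] len by (simp add: nth_append)
  qed
  moreover have "set ?es \<subseteq> S" using p e(1) set_take_subset[of j es] by (auto simp: edge_path_def)
  ultimately have "cycle G (set ?es)"
    unfolding cycle_def using S len by (intro conjI exI[of _ ?vs] exI[of _ ?es]) auto
  then show ?thesis using \<open>set ?es \<subseteq> S\<close> by blast
qed

text \<open>Evenness at the head of a path provides an edge that leaves it; this edge either closes
  a cycle or prolongs the path.\<close>
lemma edge_path_extend:
  assumes G: "finite_multigraph G" and S: "S \<subseteq> edges G" and ev: "even_degrees G S"
    and p: "edge_path G S vs es" and acyclic: "\<nexists>C. C \<subseteq> S \<and> cycle G C"
  shows "\<exists>w e. edge_path G S (w # vs) (e # es)"
proof -
  let ?v = "vs ! 0"
  have "\<exists>e\<in>S. ?v \<in> ends G e \<and> (es \<noteq> [] \<longrightarrow> e \<noteq> es ! 0)"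
  proof (cases "es = []")
    case True
    \<comment> \<open>A one-vertex path has no edge to start from; the last clause of
      \<open>edge_path\<close> supplies one.\<close>
    then show ?thesis using p by (auto simp: edge_path_def)
  next
    case False
    then have e0: "es ! 0 \<in> S" "ends G (es ! 0) = {?v, vs ! 1}" "vs ! 1 \<noteq> ?v"
      using p by (auto simp: edge_path_def nth_eq_iff_index_eq)
    have finS: "finite S" using G S by (auto simp: finite_multigraph_def intro: finite_subset)
    show ?thesis
    proof (rule ccontr)
      assume "\<not> ?thesis"
      \<comment> \<open>Otherwise \<open>es ! 0\<close>, which is not a loop, would be the only edge
        of \<open>S\<close> at the head, giving it degree 1.\<close>
      then have "incidence G e ?v = 0" if "e \<in> S - {es ! 0}" for e
        using that by (auto simp: incidence_def)
      then have "(\<Sum>e\<in>S. incidence G e ?v) = incidence G (es ! 0) ?v"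
        using sum.remove[OF finS e0(1), of "\<lambda>e. incidence G e ?v"] by simp
      also have "\<dots> = 1" using incidence_eq[OF e0(2), of ?v] e0(3) by simp
      finally show False using ev unfolding even_degrees_def by (metis odd_one)
    qed
  qed
  then obtain e where e: "e \<in> S" "?v \<in> ends G e" "es \<noteq> [] \<Longrightarrow> e \<noteq> es ! 0" by blast
  obtain w where w: "ends G e = {?v, w}" "w \<in> verts G"
  proof -
    have "e \<in> edges G" using e S by auto
    then obtain x y where "ends G e = {x, y}" "x \<in> verts G" "y \<in> verts G" by (rule ends_cases[OF G])
    then show thesis using e(2) that[of x] that[of y] by (auto simp: insert_commute)
  qed
  have "w \<notin> set vs"
  proof
    assume "w \<in> set vs"
    then obtain j where "j < length vs" "w = vs ! j" by (metis in_set_conv_nth)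
    then show False using edge_path_close[OF S p e(1) _ _ e(3)] w acyclic by blast
  qed
  moreover have "\<forall>i<length (e # es). ends G ((e # es) ! i) = {(w # vs) ! i, (w # vs) ! Suc i}"
    using p w by (auto simp: edge_path_def nth_Cons insert_commute split: nat.split)
  ultimately have "edge_path G S (w # vs) (e # es)"
    using p e w by (auto simp: edge_path_def)
  then show ?thesis by blast
qed

text \<open>Without a cycle every path could be prolonged, but a path with
  \<open>card (verts G)\<close> edges has one distinct vertex too many.\<close>

lemma even_degrees_contains_cycle:
  assumes G: "finite_multigraph G" and S: "S \<subseteq> edges G" and ev: "even_degrees G S"
    and ne: "S \<noteq> {}"
  obtains C where "C \<subseteq> S" "cycle G C"
proof (rule ccontr)
  assume "\<not> thesis"
  then have acyclic: "\<nexists>C. C \<subseteq> S \<and> cycle G C" using that by blast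
  have "\<exists>vs es. edge_path G S vs es \<and> length es = n" for n
  proof (induction n)
    case 0
    obtain e where e: "e \<in> S" using ne by blast
    with S have "e \<in> edges G" by blast
    then obtain u v where uv: "ends G e = {u, v}" "u \<in> verts G" "v \<in> verts G" by (rule ends_cases[OF G])
    have "edge_path G S [u] []" using e uv by (auto simp: edge_path_def)
    then show ?case by (intro exI[of _ "[u]"] exI[of _ "[]"]) simp
  next
    case (Suc n)
    then obtain vs es where "edge_path G S vs es" "length es = n" by blast
    moreover from this(1) obtain w e where "edge_path G S (w # vs) (e # es)"
      using edge_path_extend[OF G S ev _ acyclic] by blast
    ultimately show ?case by (intro exI[of _ "w # vs"] exI[of _ "e # es"]) simp
  qed
  then obtain vs es where p: "edge_path G S vs es" "length es = card (verts G)" by blast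
  have "finite (verts G)" using G by (simp add: finite_multigraph_def)
  then have "card (set vs) \<le> card (verts G)" using p by (intro card_mono) (auto simp: edge_path_def)
  moreover have "card (set vs) = Suc (card (verts G))" using p by (simp add: edge_path_def distinct_card)
  ultimately show False by simp
qed

text \<open>The peeling argument used for cutsets, with additivity of degrees in place of linearity
  of the coboundary.\<close>

lemma disjoint_union_cycles_iff:
  assumes G: "finite_multigraph G" and S: "S \<subseteq> edges G"
  shows "disjoint_union_of (cycle G) S \<longleftrightarrow> even_degrees G S"
proof
  have finE: "finite (edges G)" using G by (simp add: finite_multigraph_def)
  show "even_degrees G S" if "disjoint_union_of (cycle G) S"
    using finite_subset[OF S finE] that
  proof (induction rule: disjoint_union_of_induct)
    case (step C T)
    have "finite C" "finite T" using step S finE by (meson finite_subset)+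
    then show ?case
      using even_degrees_cycle[OF step(1)] step(4,5) by (simp add: even_degrees_def sum.union_disjoint)
  qed (simp add: even_degrees_def)
  assume "even_degrees G S"
  with finite_subset[OF S finE] show "disjoint_union_of (cycle G) S" using S
  proof (induction S rule: finite_psubset_induct)
    case (psubset S)
    show ?case
    proof (cases "S = {}")
      case False
      then obtain C where C: "C \<subseteq> S" "cycle G C"
        using even_degrees_contains_cycle[OF G] psubset by metis
      have "even (\<Sum>e\<in>S - C. incidence G e v)" for v
      proof -
        have "(\<Sum>e\<in>S. incidence G e v) = (\<Sum>e\<in>S - C. incidence G e v) + (\<Sum>e\<in>C. incidence G e v)"
          using sum.subset_diff[OF C(1) psubset(1)] .
        then show ?thesis
          using even_degrees_cycle[OF C(2)] psubset(3) by (metis even_degrees_def even_add)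
      qed
      then have "even_degrees G (S - C)" by (simp add: even_degrees_def)
      moreover have "C \<noteq> {}" using C(2) by (auto simp: cycle_def)
      then have "S - C \<subset> S" using C(1) by blast
      ultimately have "disjoint_union_of (cycle G) (S - C)" using psubset by blast
      then show ?thesis using disjoint_union_of_insert C by metis
    qed (simp add: disjoint_union_of_empty)
  qed
qed

subsection \<open>Evaluation of the flow polynomial\<close>

lemma orientation_exists:
  assumes G: "finite_multigraph G"
  obtains t h where "orientation G t h"
proof -
  have "\<forall>e\<in>edges G. \<exists>p. ends G e = {fst p, snd p}"
  proof
    fix e assume "e \<in> edges G"
    then obtain u v where "ends G e = {u, v}" by (rule ends_cases[OF G])
    then have "ends G e = {fst (u, v), snd (u, v)}" by simp
    then show "\<exists>p. ends G e = {fst p, snd p}" by blast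
  qed
  from bchoice[OF this] obtain p where "\<forall>e\<in>edges G. ends G e = {fst (p e), snd (p e)}" ..
  then show thesis using that[of "fst \<circ> p" "snd \<circ> p"] by (simp add: orientation_def)
qed

lemma finite_carrier_integer_mod_group:
  assumes "n > 0"
  shows "finite (carrier (integer_mod_group n))" "card (carrier (integer_mod_group n)) = n"
  using assms by (auto simp: carrier_integer_mod_group)

lemma poly_flow_poly:
  fixes H :: "int monoid"
  assumes G: "finite_multigraph G" and "orientation G t h" "comm_group H" "finite (carrier H)"
  shows "poly (flow_poly G) (int (card (carrier H))) = int (card (nowhere_zero_flows G t h H))"
proof -
  let ?P = "\<lambda>p. \<forall>t h (H :: int monoid). orientation G t h \<longrightarrow> comm_group H \<longrightarrow>
    finite (carrier H) \<longrightarrow> poly p (int (card (carrier H))) = int (card (nowhere_zero_flows G t h H))"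
  have "\<exists>!p. ?P p"
  proof (rule ex_ex1I)
    have "finite (edges G)" using G by (simp add: finite_multigraph_def)
    then obtain p where "\<And>t h (H :: int monoid). (\<forall>e\<in>edges G. ends G e = {t e, h e}) \<Longrightarrow>
        comm_group H \<Longrightarrow> finite (carrier H) \<Longrightarrow>
        poly p (int (card (carrier H))) = int (card (nowhere_zero_flows_on (edges G) t h H))"
      using card_flows_polynomial[of "edges G" "ends G"] by blast
    then have "?P p" by (simp add: nowhere_zero_flows_eq[OF G] orientation_def)
    then show "\<exists>p. ?P p" by blast
  next
    fix p q assume pq: "?P p" "?P q"
    obtain t h where o: "orientation G t h" using orientation_exists[OF G] .
    have "poly p (int n) = poly q (int n)" if "n > 0" for n
      using pq o finite_carrier_integer_mod_group[OF that] abelian_integer_mod_group[of n] by metis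
    then show "p = q" by (rule int_poly_eqI)
  qed
  from theI'[OF this] show ?thesis using assms unfolding flow_poly_def by blast
qed

text \<open>The only nontrivial group element is 1, so the constant 1 is the only candidate. It is a
  flow if and only if out-degree and in-degree agree modulo 2 everywhere, i.e. their sum is
  even.\<close>

lemma card_nowhere_zero_flows_mod_2:
  assumes G: "finite_multigraph G" and o: "orientation G t h"
  shows "card (nowhere_zero_flows G t h (integer_mod_group 2)) = (if even_degrees G (edges G) then 1 else 0)"
proof -
  let ?H = "integer_mod_group 2" and ?one = "\<lambda>e\<in>edges G. 1 :: int"
  interpret comm_group ?H by simp
  have fin: "finite (edges G)" using G by (simp add: finite_multigraph_def)
  have carr: "carrier ?H - {\<one>\<^bsub>?H\<^esub>} = {1}" by (auto simp: carrier_integer_mod_group)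
  have prod: "finprod ?H ?one {e \<in> edges G. s e = v} = int (card {e \<in> edges G. s e = v}) mod 2"
    for s :: "'b \<Rightarrow> 'a" and v
  proof -
    have "finprod ?H ?one {e \<in> edges G. s e = v} = finprod ?H (\<lambda>e. 1) {e \<in> edges G. s e = v}"
      by (intro finprod_cong') auto
    also have "\<dots> = int (card {e \<in> edges G. s e = v}) mod 2"
      by (subst finprod_const) auto
    finally show ?thesis .
  qed
  have deg: "(\<Sum>e\<in>edges G. incidence G e v) = card {e \<in> edges G. t e = v} + card {e \<in> edges G. h e = v}" for v
  proof -
    have "(\<Sum>e\<in>edges G. incidence G e v) = (\<Sum>e\<in>edges G. of_bool (t e = v) + of_bool (h e = v))"
      using o by (intro sum.cong incidence_eq) (auto simp: orientation_def)
    also have "\<dots> = card {e \<in> edges G. t e = v} + card {e \<in> edges G. h e = v}"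
      using fin by (simp add: sum.distrib Int_def)
    finally show ?thesis .
  qed
  have parity: "int a mod 2 = int b mod 2 \<longleftrightarrow> even (a + b)" for a b by presburger
  have "nowhere_zero_flows_on (edges G) t h ?H = (if even_degrees G (edges G) then {?one} else {})"
    unfolding nowhere_zero_flows_on_def carr PiE_singleton
    by (auto simp: prod parity deg even_degrees_def PiE_def)
  then show ?thesis unfolding nowhere_zero_flows_eq[OF G o] by simp
qed

lemma flow_poly_2:
  assumes G: "finite_multigraph G"
  shows "poly (flow_poly G) 2 = (if disjoint_union_of (cycle G) (edges G) then 1 else 0)"
proof -
  obtain t h where o: "orientation G t h" using orientation_exists[OF G] .
  then show ?thesis
    using poly_flow_poly[OF G o, of "integer_mod_group 2"] finite_carrier_integer_mod_group[of 2]
      card_nowhere_zero_flows_mod_2[OF G o] disjoint_union_cycles_iff[OF G order.refl]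
    by simp
qed

theorem theorem1p1:
  fixes G :: "('v, 'e) multigraph" and c :: nat
  assumes "finite_multigraph G"
    and "c = num_components G (edges G)"
  shows "card (cutset_pairs G 1) = card (cutset_pairs G 3) \<and>
         real (card (cutset_pairs G 0)) - real (card (cutset_pairs G 2)) =
           2 powi (int (card (edges G)) - int c) * real_of_int (poly (chromatic_poly G) 2) \<and>
         card (cycle_pairs G 1) = card (cycle_pairs G 3) \<and>
         int (card (cycle_pairs G 0)) - int (card (cycle_pairs G 2)) =
           2 ^ card (edges G) * poly (flow_poly G) 2"
proof -
  let ?E = "edges G"
  have fin: "finite ?E" using assms by (simp add: finite_multigraph_def)
  have cut: "cutset_pairs G k = sym_diff_pairs ?E (disjoint_union_of (minimal_cutset G)) k"
    and cyc: "cycle_pairs G k = sym_diff_pairs ?E (disjoint_union_of (cycle G)) k" for k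
    by (simp_all add: cutset_pairs_def cycle_pairs_def sym_diff_pairs_def)
  have "int (card (cutset_pairs G 0)) - int (card (cutset_pairs G 2)) =
      (if disjoint_union_of (minimal_cutset G) ?E then 2 ^ card ?E else 0)"
    unfolding cut card_sym_diff_pairs(2)[OF fin] by simp
  then have "real (card (cutset_pairs G 0)) - real (card (cutset_pairs G 2)) =
      (if disjoint_union_of (minimal_cutset G) ?E then 2 ^ card ?E else 0)"
    by (metis (mono_tags, lifting) of_int_0 of_int_diff of_int_numeral of_int_of_nat_eq of_int_power)
  \<comment> \<open>With many isolated vertices \<open>c\<close> exceeds the number of edges; hence
    the integer exponent and the passage to the reals.\<close>
  moreover have "2 powi (int (card ?E) - int c) * (2 :: real) ^ c = 2 ^ card ?E"
    by (simp add: power_int_diff)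
  ultimately show ?thesis
    using card_sym_diff_pairs[OF fin] chromatic_poly_2[OF assms(1)] flow_poly_2[OF assms(1)] assms(2)
    unfolding cut cyc by auto
qed

end
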